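(* Let $G$ be a connected graph with $n$ vertices and $m$ edges, where $n \geq 14$. Then $$\chi(G) \leq \frac{m}{\sqrt{n}}.$$ Moreover, the bound $14$ is best possible: there exists a connected graph $G$ with $n = 13$ vertices and some number $m$ of edges such that $\chi(G) > \frac{m}{\sqrt{n}}$.
   Context: All graphs are finite and simple (no loops, no multiple edges). $\chi(G)$ denotes the (vertex) chromatic number of $G$. *)

theory Defs
  imports Complex_Main
begin

definition simple_graph :: "'a set \<Rightarrow> 'a set set \<Rightarrow> bool" where
  "simple_graph V E \<longleftrightarrow> finite V \<and> (\<forall>e\<in>E. e \<subseteq> V \<and> card e = 2)"

text \<open>The reflexive transitive closure relates exactly the pairs of vertices joined by a walk;
  as usual, the graph without vertices does not count as connected.\<close>

definition connected_graph :: "'a set \<Rightarrow> 'a set set \<Rightarrow> bool" where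
  "connected_graph V E \<longleftrightarrow>
     simple_graph V E \<and> V \<noteq> {} \<and> (\<forall>u\<in>V. \<forall>v\<in>V. (u, v) \<in> {(x, y). {x, y} \<in> E}\<^sup>*)"

definition proper_coloring :: "'a set \<Rightarrow> 'a set set \<Rightarrow> nat \<Rightarrow> ('a \<Rightarrow> nat) \<Rightarrow> bool" where
  "proper_coloring V E k c \<longleftrightarrow>
     (\<forall>v\<in>V. c v < k) \<and> (\<forall>u\<in>V. \<forall>v\<in>V. {u, v} \<in> E \<longrightarrow> c u \<noteq> c v)"

text \<open>For a simple graph some number of colors always suffices (color the finitely many vertices
  injectively), so the least element below is a genuine minimum.\<close>

definition chromatic_number :: "'a set \<Rightarrow> 'a set set \<Rightarrow> nat" where
  "chromatic_number V E = (LEAST k. \<exists>c. proper_coloring V E k c)"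

end

theory Submission
  imports Defs
begin

text \<open>
  A connected graph with chromatic number \<open>k\<close> has at least \<open>k (k - 1) / 2 + (n - k)\<close> edges, as
  many as a clique on \<open>k\<close> vertices with all other vertices hanging from it. To see this, reveal
  the vertices one at a time so that each new vertex has a neighbour among the earlier ones, and
  color greedily: a new vertex costs at least one edge, and a new color is added to
  \<open>k\<close> present ones only when the new vertex has at least \<open>k\<close> earlier neighbours, which costs \<open>k\<close>
  edges (lemma \<open>greedy_coloring_edges\<close>).

  The edge bound is used for the number \<open>k\<close> of colors that the greedy procedure ends with, which is
  at least the chromatic number. In the form \<open>2 n + k\<^sup>2 \<le> 2 m + 3 k\<close>, it reduces the claim to the quadratic inequality
  \<open>2 k s \<le> 2 s\<^sup>2 + k\<^sup>2 - 3 k\<close> with \<open>s = sqrt n\<close>. The discriminant is negative for \<open>k > 6\<close> and zero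
  for \<open>k = 6\<close>; the worst case is \<open>k = 5\<close>, where the larger root is \<open>(5 + sqrt 5) / 2\<close>, whose
  square lies between 13 and 14. The extremal graph for \<open>k = 5\<close> and \<open>n = 13\<close>, a clique on five
  vertices with eight pendant edges, therefore violates the bound.
\<close>

section \<open>Edges forced by the chromatic number\<close>

lemma connected_graph_crossing_edge:
  assumes "connected_graph V E" "S \<subseteq> V" "S \<noteq> {}" "S \<noteq> V"
  obtains v w where "v \<in> V - S" "w \<in> S" "{v, w} \<in> E"
proof -
  obtain u where u: "u \<in> S" using assms by blast
  obtain x where x: "x \<in> V" "x \<notin> S" using assms by blast
  have "(u, x) \<in> {(x, y). {x, y} \<in> E}\<^sup>*"
    using assms u x by (auto simp: connected_graph_def)
  then have "x \<notin> S \<longrightarrow> (\<exists>a b. a \<in> S \<and> b \<notin> S \<and> {a, b} \<in> E)"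
    using u by (induction rule: rtrancl_induct) auto
  with x obtain a b where ab: "a \<in> S" "b \<notin> S" "{a, b} \<in> E" by blast
  moreover have "b \<in> V"
    using assms(1) ab by (auto simp: connected_graph_def simple_graph_def)
  ultimately show thesis using that[of b a] by (simp add: insert_commute)
qed

text \<open>The greedy step: fewer than \<open>k\<close> earlier neighbours cannot block all \<open>k\<close> colors, so the new
  vertex reuses one; otherwise it gets a fresh color, and its at least \<open>k\<close> new edges pay for the growth of the quadratic
  term.\<close>

lemma greedy_coloring_extend:
  assumes fin: "finite S" and finE: "finite E" and no_loop: "{v} \<notin> E"
    and v: "v \<notin> S" and w: "w \<in> S" "{v, w} \<in> E"
    and col: "proper_coloring S E k c"
    and bound: "2 * card S + k\<^sup>2 \<le> 2 * card {e \<in> E. e \<subseteq> S} + 3 * k"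
  shows "\<exists>k c. proper_coloring (insert v S) E k c \<and>
           2 * card (insert v S) + k\<^sup>2 \<le> 2 * card {e \<in> E. e \<subseteq> insert v S} + 3 * k"
proof -
  define N where "N = {x \<in> S. {v, x} \<in> E}"
  have finN: "finite N" using fin by (simp add: N_def)
  have "card N > 0" using w finN by (auto simp: N_def card_gt_0_iff)
  have "inj_on (\<lambda>x. {v, x}) N"
    using v by (auto simp: inj_on_def N_def doubleton_eq_iff)
  then have "card {e \<in> E. e \<subseteq> S} + card N = card ({e \<in> E. e \<subseteq> S} \<union> (\<lambda>x. {v, x}) ` N)"
    using v finE finN by (subst card_Un_disjoint) (auto simp: card_image)
  also have "\<dots> \<le> card {e \<in> E. e \<subseteq> insert v S}"
    using finE by (intro card_mono) (auto simp: N_def)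
  finally have edges: "card {e \<in> E. e \<subseteq> S} + card N \<le> card {e \<in> E. e \<subseteq> insert v S}" .
  have size: "card (insert v S) = Suc (card S)" using fin v by simp
  have recolor: "proper_coloring (insert v S) E l (c(v := a))"
    if "a < l" "k \<le> l" "a \<notin> c ` N" for a l
    using col that v no_loop
    by (fastforce simp: proper_coloring_def N_def insert_commute)
  show ?thesis
  proof (cases "card N < k")
    case True
    have "\<not> {..<k} \<subseteq> c ` N"
      using True card_image_le[OF finN, of c] card_mono[of "c ` N" "{..<k}"] finN by force
    then obtain a where "a < k" "a \<notin> c ` N" by blast
    then have "proper_coloring (insert v S) E k (c(v := a))" by (intro recolor) auto
    then show ?thesis using bound edges size \<open>card N > 0\<close> by fastforce
  next
    case False
    have "k \<notin> c ` N" using col by (force simp: proper_coloring_def N_def)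
    then have "proper_coloring (insert v S) E (Suc k) (c(v := k))" by (intro recolor) auto
    moreover have "2 * card (insert v S) + (Suc k)\<^sup>2
        \<le> 2 * card {e \<in> E. e \<subseteq> insert v S} + 3 * Suc k"
      using bound edges size False by (simp add: power2_eq_square)
    ultimately show ?thesis by blast
  qed
qed

text \<open>Growing a vertex set one neighbour at a time needs connectivity only of the whole graph:
  every nonempty proper vertex subset is left by some edge.\<close>

lemma greedy_coloring_edges:
  assumes "connected_graph V E"
  shows "\<exists>k c. proper_coloring V E k c \<and> 2 * card V + k\<^sup>2 \<le> 2 * card E + 3 * k"
proof -
  have finV: "finite V" and sub: "\<And>e. e \<in> E \<Longrightarrow> e \<subseteq> V" and "V \<noteq> {}"
    and two: "\<And>e. e \<in> E \<Longrightarrow> card e = 2"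
    using assms by (auto simp: connected_graph_def simple_graph_def)
  have finE: "finite E" using finV sub by (meson Pow_iff finite_Pow_iff finite_subset subsetI)
  have no_loop: "{v} \<notin> E" for v using two[of "{v}"] by auto
  have "\<exists>S k c. S \<subseteq> V \<and> card S = Suc j \<and> proper_coloring S E k c \<and>
          2 * card S + k\<^sup>2 \<le> 2 * card {e \<in> E. e \<subseteq> S} + 3 * k" if "Suc j \<le> card V" for j
    using that
  proof (induction j)
    case 0
    obtain u where "u \<in> V" using \<open>V \<noteq> {}\<close> by blast
    moreover have "proper_coloring {u} E 1 (\<lambda>_. 0)"
      using no_loop by (simp add: proper_coloring_def)
    ultimately show ?case
      by (intro exI[of _ "{u}"] exI[of _ 1] exI[of _ "\<lambda>_. 0"]) auto
  next
    case (Suc j)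
    then obtain S k c where S: "S \<subseteq> V" "card S = Suc j" "proper_coloring S E k c"
      "2 * card S + k\<^sup>2 \<le> 2 * card {e \<in> E. e \<subseteq> S} + 3 * k" by auto
    have "S \<noteq> {}" "S \<noteq> V" using S(2) Suc.prems by auto
    then obtain v w where vw: "v \<in> V - S" "w \<in> S" "{v, w} \<in> E"
      using connected_graph_crossing_edge[OF assms S(1)] by metis
    have finS: "finite S" using S(1) finV finite_subset by blast
    have "insert v S \<subseteq> V" "card (insert v S) = Suc (Suc j)"
      using vw S finS by auto
    then show ?case
      using greedy_coloring_extend[OF finS finE no_loop _ vw(2,3) S(3,4)] vw(1) by blast
  qed
  from this[of "card V - 1"] obtain S k c where S: "S \<subseteq> V" "card S = card V"
    "proper_coloring S E k c" "2 * card S + k\<^sup>2 \<le> 2 * card {e \<in> E. e \<subseteq> S} + 3 * k"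
    using finV \<open>V \<noteq> {}\<close> by (auto simp: Suc_le_eq card_gt_0_iff)
  then have "S = V" using finV card_subset_eq by blast
  moreover have "{e \<in> E. e \<subseteq> V} = E" using sub by blast
  ultimately show ?thesis using S by auto
qed

lemma chromatic_number_le: "proper_coloring V E k c \<Longrightarrow> chromatic_number V E \<le> k"
  unfolding chromatic_number_def by (rule Least_le) blast

section \<open>The quadratic inequality\<close>

lemma colors_le_edges_div_sqrt:
  fixes n m k :: nat
  assumes n: "n \<ge> 14" and bound: "2 * n + k\<^sup>2 \<le> 2 * m + 3 * k"
  shows "real k \<le> real m / sqrt (real n)"
proof -
  define s where "s = sqrt (real n)"
  have s2: "s\<^sup>2 = real n" by (simp add: s_def)
  (* 3.7 separates sqrt 14 from the critical root (5 + sqrt 5) / 2 for k = 5 *)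
  have s: "s \<ge> 3.7"
    unfolding s_def using n by (intro real_le_rsqrt) (simp add: power2_eq_square)
  have "2 * s\<^sup>2 + (real k)\<^sup>2 \<le> 2 * real m + 3 * real k"
    using bound unfolding s2 by (simp flip: of_nat_power of_nat_mult of_nat_add)
  moreover have "2 * real k * s \<le> 2 * s\<^sup>2 + (real k)\<^sup>2 - 3 * real k"
  proof (cases "k \<le> 5")
    case True
    have "(s - 3.7) * s \<ge> 0" "(s - 3.7) * (s - 3.7) \<ge> 0" using s by auto
    moreover have "k = 0 \<or> k = 1 \<or> k = 2 \<or> k = 3 \<or> k = 4 \<or> k = 5" using True by auto
    ultimately show ?thesis
      using s by (elim disjE) (simp_all add: power2_eq_square algebra_simps)
  next
    case False
    then have "real k * (real k - 6) \<ge> 0" by simp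
    moreover have "(2 * s - real k)\<^sup>2 \<ge> 0" by simp
    ultimately show ?thesis by (simp add: power2_eq_square algebra_simps)
  qed
  ultimately have "real k * s \<le> real m" by linarith
  then show ?thesis unfolding s_def[symmetric] using s by (simp add: pos_le_divide_eq)
qed

section \<open>A clique with pendant edges\<close>

lemma clique_card_le_chromatic_number:
  fixes V :: "nat set"
  assumes V: "finite V" and no_loop: "\<And>v. {v} \<notin> E" and K: "K \<subseteq> V"
    and clique: "\<And>u v. u \<in> K \<Longrightarrow> v \<in> K \<Longrightarrow> u \<noteq> v \<Longrightarrow> {u, v} \<in> E"
  shows "card K \<le> chromatic_number V E"
proof -
  have "proper_coloring V E (Suc (Max V)) id"
    using V no_loop by (auto simp: proper_coloring_def le_imp_less_Suc)
  then have "\<exists>k c. proper_coloring V E k c" by blast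
  then have "\<exists>c. proper_coloring V E (chromatic_number V E) c"
    unfolding chromatic_number_def by (rule LeastI_ex)
  then obtain c where c: "proper_coloring V E (chromatic_number V E) c" ..
  have "inj_on c K"
    using c K clique unfolding proper_coloring_def inj_on_def by blast
  moreover have "c ` K \<subseteq> {..<chromatic_number V E}"
    using c K by (auto simp: proper_coloring_def)
  ultimately show ?thesis using card_inj_on_le[of c K "{..<chromatic_number V E}"] by simp
qed

text \<open>The clique is \<open>{0..4}\<close>, and the eight further vertices hang from 0; thus 0 is adjacent to
  every other vertex, and only six clique edges avoid it.\<close>

lemma sharpness_example:
  "\<exists>(V :: nat set) (E :: nat set set) (m :: nat).
     connected_graph V E \<and> card V = 13 \<and> card E = m \<and>
     real (chromatic_number V E) > real m / sqrt 13"
proof -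
  define V :: "nat set" where "V = {0..12}"
  define R :: "nat set set" where "R = {{1, 2}, {1, 3}, {1, 4}, {2, 3}, {2, 4}, {3, 4}}"
  define E where "E = (\<lambda>i. {0, i}) ` {1..12} \<union> R"
  have "card E \<le> card ((\<lambda>i. {0, i}) ` {1..12::nat}) + card R"
    unfolding E_def by (rule card_Un_le)
  moreover have "card ((\<lambda>i. {0, i}) ` {1..12::nat}) \<le> 12"
    using card_image_le[of "{1..12::nat}" "\<lambda>i. {0, i}"] by simp
  moreover have "card R \<le> 6"
    unfolding R_def by (simp add: card_insert_if)
  ultimately have cardE: "card E \<le> 18" by linarith
  have simple: "simple_graph V E"
    by (auto simp: simple_graph_def V_def E_def R_def card_insert_if)
  have star: "{0, v} \<in> E" if "v \<in> V" "v \<noteq> 0" for v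
    using that by (auto simp: E_def V_def)
  have from0: "(0, v) \<in> {(x, y). {x, y} \<in> E}\<^sup>*" and to0: "(v, 0) \<in> {(x, y). {x, y} \<in> E}\<^sup>*"
    if "v \<in> V" for v
    using star[OF that] by (cases "v = 0"; auto simp: insert_commute)+
  have "connected_graph V E"
    unfolding connected_graph_def
  proof (intro conjI ballI)
    show "V \<noteq> {}" by (simp add: V_def)
    show "(u, v) \<in> {(x, y). {x, y} \<in> E}\<^sup>*" if "u \<in> V" "v \<in> V" for u v
      using to0[OF that(1)] from0[OF that(2)] by (rule rtrancl_trans)
  qed (rule simple)
  moreover have "5 \<le> chromatic_number V E"
  proof -
    have "card {0..4::nat} \<le> chromatic_number V E"
    proof (rule clique_card_le_chromatic_number)
      show "{v} \<notin> E" for v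
        using simple by (auto simp: simple_graph_def dest!: bspec[of E _ "{v}"])
      have increasing: "{u, v} \<in> E" if "u < v" "v \<le> 4" for u v
      proof (cases "u = 0")
        case True
        then show ?thesis using star[of v] that by (simp add: V_def)
      next
        case False
        then have "u = 1 \<and> v = 2 \<or> u = 1 \<and> v = 3 \<or> u = 1 \<and> v = 4 \<or>
            u = 2 \<and> v = 3 \<or> u = 2 \<and> v = 4 \<or> u = 3 \<and> v = 4"
          using that by linarith
        then show ?thesis unfolding E_def R_def by (elim disjE conjE) simp_all
      qed
      show "{u, v} \<in> E" if "u \<in> {0..4}" "v \<in> {0..4}" "u \<noteq> v" for u v
        using that increasing[of u v] increasing[of v u]
        by (cases "u < v") (simp_all add: insert_commute)
    qed (auto simp: V_def)
    then show ?thesis by simp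
  qed
  moreover have "real (card E) / sqrt 13 < 5"
  proof -
    (* 18\<^sup>2 = 324 just misses 5\<^sup>2 * 13 = 325 *)
    have "18 / 5 < sqrt 13" by (rule real_less_rsqrt) (simp add: power2_eq_square)
    then show ?thesis using cardE by (simp add: pos_divide_less_eq)
  qed
  ultimately have "connected_graph V E" "card V = 13"
    "real (card E) / sqrt 13 < real (chromatic_number V E)"
    by (auto simp: V_def)
  then show ?thesis by blast
qed

theorem theorem5:
  shows "(\<forall>(V :: 'a set) (E :: 'a set set) (n :: nat) (m :: nat).
            connected_graph V E \<and> card V = n \<and> card E = m \<and> n \<ge> 14 \<longrightarrow>
            real (chromatic_number V E) \<le> real m / sqrt (real n)) \<and>
         (\<exists>(V :: nat set) (E :: nat set set) (m :: nat).
            connected_graph V E \<and> card V = 13 \<and> card E = m \<and>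
            real (chromatic_number V E) > real m / sqrt 13)"
proof (intro conjI allI impI)
  fix V :: "'a set" and E :: "'a set set" and n m :: nat
  assume G: "connected_graph V E \<and> card V = n \<and> card E = m \<and> n \<ge> 14"
  then obtain k c where kc: "proper_coloring V E k c" "2 * n + k\<^sup>2 \<le> 2 * m + 3 * k"
    using greedy_coloring_edges[of V E] by auto
  have "real (chromatic_number V E) \<le> real k" using chromatic_number_le[OF kc(1)] by simp
  also have "\<dots> \<le> real m / sqrt (real n)" using G kc(2) by (intro colors_le_edges_div_sqrt) auto
  finally show "real (chromatic_number V E) \<le> real m / sqrt (real n)" .
qed (rule sharpness_example)

end
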